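(* The set $$X_\infty=\Big\{x\in\mathbb T:\liminf_{n\to\infty}\frac1n\sum_{i=1}^n\log_2 d(T^ix,x)=-\infty\Big\}$$ has Hausdorff dimension zero.
   Context: $\mathbb T=\mathbb R/\mathbb Z$, $Tx=2x\bmod1$, $d(t,s)=\|t-s\|$ with $\|x\|=\inf_{n\in\mathbb Z}|x-n|$; convention $\log_2 0=-\infty$. *)

theory Defs
  imports "HOL-Analysis.Analysis"
begin

text \<open>The circle T = R/Z is represented by the fundamental domain [0,1).\<close>

definition circle :: "real set" where
  "circle = {0..<1}"

definition circ_norm :: "real \<Rightarrow> real" where
  "circ_norm x = (INF n::int. \<bar>x - of_int n\<bar>)"

definition dT :: "real \<Rightarrow> real \<Rightarrow> real" where
  "dT t s = circ_norm (t - s)"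

definition doubling :: "real \<Rightarrow> real" where
  "doubling x = frac (2 * x)"

definition elog2 :: "real \<Rightarrow> ereal" where
  "elog2 y = (if y = 0 then -\<infinity> else ereal (log 2 y))"

definition X_infty :: "real set" where
  "X_infty = {x \<in> circle.
     liminf (\<lambda>n::nat. ereal (1 / real n) *
        (\<Sum>i=1..n. elog2 (dT ((doubling ^^ i) x) x))) = -\<infinity>}"

definition diamT :: "real set \<Rightarrow> real" where
  "diamT S = (if S = {} then 0 else Sup {dT x y | x y. x \<in> S \<and> y \<in> S})"

definition diam_pow :: "real \<Rightarrow> real set \<Rightarrow> ennreal" where
  "diam_pow s S = (if S = {} then 0
      else if diamT S = 0 then (if s = 0 then 1 else 0)
      else ennreal (diamT S powr s))"

definition hausdorff_pre :: "real \<Rightarrow> real \<Rightarrow> real set \<Rightarrow> ennreal" where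
  "hausdorff_pre s \<delta> A = (INF C \<in> {C :: nat \<Rightarrow> real set.
       A \<subseteq> (\<Union>i. C i) \<and> (\<forall>i. C i \<subseteq> circle \<and> diamT (C i) \<le> \<delta>)}.
       (\<Sum>i. diam_pow s (C i)))"

definition hausdorff_measure :: "real \<Rightarrow> real set \<Rightarrow> ennreal" where
  "hausdorff_measure s A = (SUP \<delta> \<in> {0<..}. hausdorff_pre s \<delta> A)"

definition hausdorff_dim :: "real set \<Rightarrow> ereal" where
  "hausdorff_dim A = Inf {ereal s | s. s \<ge> 0 \<and> hausdorff_measure s A = 0}"

end

(*
  Write near x i k for d(T^i x, x) <= 2^-k. If l is large and near x i l holds, then x on the
  digits i, ..., i + l - 1 is a copy of its own prefix, so 2^-(i+l)-approximations of x are
  determined, up to boundedly many choices, by 2^-i-approximations. Hence the points for which,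
  for infinitely many m, the first m digits consist of long copies up to at most eps * m free
  digits have Hausdorff dimension that tends to 0 with eps.

  Every x in X_infty is of this kind. Otherwise near x i k forces k <= C i + B, since one copy of
  length C i already makes the prefix of length i + C i mostly copied. Let A(m) be the number of
  pairs (i, k) with near x i k, 1 <= i, K <= k and i + k <= m. Choose greedily, longest first,
  disjoint copies of lengths l_1, l_2, ... such that each pair meets a copy at least as long as
  itself. Pairs inside the j-th copy are also pairs of the prefix of length l_j; pairs across one of its ends are O(l_j) many,
  because overlapping occurrences of the prefix of length k are at least k / (2C + 2) apart.
  So A(m) <= sum_j (A(l_j) + c l_j) while sum_j l_j <= (1 - eps) m, which gives A(m) <= (c / eps) m.
  This bounds the averages of log_2 d(T^i x, x) from below.
*)
theory Submission
  imports Defs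
begin

subsection \<open>Close returns\<close>

lemma circ_norm_nonneg: "0 \<le> circ_norm x"
  unfolding circ_norm_def by (rule cINF_greatest) auto

lemma circ_norm_le: "circ_norm x \<le> \<bar>x - of_int n\<bar>"
  unfolding circ_norm_def by (rule cINF_lower) (auto intro!: bdd_belowI[where m = 0])

lemma circ_norm_le_abs: "circ_norm x \<le> \<bar>x\<bar>"
  using circ_norm_le[of x 0] by simp

text \<open>Rounding realises the infimum. Estimates can then be made with actual nearest integers,
  which may be added and multiplied.\<close>

lemma circ_norm_attained: "\<exists>n::int. circ_norm x = \<bar>x - of_int n\<bar>"
proof -
  have "circ_norm x = \<bar>x - of_int (round x)\<bar>"
  proof (rule antisym)
    show "\<bar>x - of_int (round x)\<bar> \<le> circ_norm x"
      unfolding circ_norm_def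
      by (rule cINF_greatest) (auto intro: round_diff_minimal)
  qed (rule circ_norm_le)
  then show ?thesis ..
qed

lemma circ_norm_diff_of_int [simp]: "circ_norm (x - of_int n) = circ_norm x"
proof -
  have le: "circ_norm (y - of_int k) \<le> circ_norm y" for y k
  proof -
    obtain j :: int where "circ_norm y = \<bar>y - of_int j\<bar>"
      using circ_norm_attained by blast
    then show ?thesis using circ_norm_le[of "y - of_int k" "j - k"] by simp
  qed
  show ?thesis using le[of x n] le[of "x - of_int n" "- n"] by simp
qed

lemma circ_norm_triangle: "circ_norm (x - y) \<le> circ_norm x + circ_norm y"
proof -
  obtain m n :: int where "circ_norm x = \<bar>x - of_int m\<bar>" "circ_norm y = \<bar>y - of_int n\<bar>"
    using circ_norm_attained by metis
  then show ?thesis using circ_norm_le[of "x - y" "m - n"] by simp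
qed

lemma circ_norm_of_int_mult_le: "circ_norm (of_int k * x) \<le> \<bar>of_int k\<bar> * circ_norm x"
proof -
  obtain m :: int where m: "circ_norm x = \<bar>x - of_int m\<bar>"
    using circ_norm_attained by metis
  have "circ_norm (of_int k * x) \<le> \<bar>of_int k * x - of_int (k * m)\<bar>" by (rule circ_norm_le)
  also have "\<dots> = \<bar>of_int k\<bar> * circ_norm x"
    by (simp add: m abs_mult[symmetric] right_diff_distrib)
  finally show ?thesis .
qed

lemma circ_norm_power2_mult_le: "circ_norm (2 ^ r * x) \<le> 2 ^ r * circ_norm x"
  using circ_norm_of_int_mult_le[of "2 ^ r" x] by simp

lemma doubling_funpow: "0 \<le> x \<Longrightarrow> x < 1 \<Longrightarrow> (doubling ^^ i) x = frac (2 ^ i * x)"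
proof (induction i)
  case 0
  then show ?case by (simp add: frac_eq)
next
  case (Suc i)
  have "2 * frac (2 ^ i * x) = 2 ^ Suc i * x - of_int (2 * \<lfloor>2 ^ i * x\<rfloor>)"
    by (simp add: frac_def algebra_simps)
  then show ?case
    by (smt (verit, best) Suc doubling_def frac_def floor_diff_of_int comp_apply funpow.simps(2) of_int_diff)
qed

text \<open>The orbit point differs from \<open>2 ^ i * x\<close> by an integer, which
  \<open>circ_norm\<close> ignores. What remains is linear in \<open>x\<close>, so the triangle
  inequality and integer multiples apply to it.\<close>

lemma dT_doubling_funpow:
  assumes "x \<in> circle"
  shows "dT ((doubling ^^ i) x) x = circ_norm ((2 ^ i - 1) * x)"
proof -
  have "(doubling ^^ i) x - x = (2 ^ i - 1) * x - of_int \<lfloor>2 ^ i * x\<rfloor>"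
    using assms by (simp add: doubling_funpow circle_def frac_def algebra_simps)
  then show ?thesis by (simp add: dT_def)
qed

text \<open>A metric substitute for equality of digits that tolerates carries. At nonzero distance
  it holds exactly for \<open>k\<close> up to minus the binary logarithm of the distance, so
  logarithms can be measured by counting \<open>k\<close>.\<close>

definition near :: "real \<Rightarrow> nat \<Rightarrow> nat \<Rightarrow> bool" where
  "near x i k \<longleftrightarrow> circ_norm ((2 ^ i - 1) * x) \<le> 1 / 2 ^ k"

lemma near_mono: "near x i k \<Longrightarrow> j \<le> k \<Longrightarrow> near x i j"
  unfolding near_def by (erule order_trans) (simp add: frac_le)

text \<open>A return at \<open>i + r\<close> inside a copy of the prefix is carried back to position
  \<open>r\<close>. Multiplication by \<open>2 ^ r\<close> uses up \<open>r\<close> digits of the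
  copy, and adding two errors costs one more, hence \<open>Suc j\<close>.\<close>

lemma near_shift:
  assumes "near x i l" "near x (i + r) k" "Suc j \<le> k" "r + Suc j \<le> l"
  shows "near x r j"
proof -
  have "(2 ^ r - 1) * x = (2 ^ (i + r) - 1) * x - 2 ^ r * ((2 ^ i - 1) * x)"
    by (simp add: algebra_simps power_add)
  then have "circ_norm ((2 ^ r - 1) * x) \<le>
      circ_norm ((2 ^ (i + r) - 1) * x) + 2 ^ r * circ_norm ((2 ^ i - 1) * x)"
    using circ_norm_triangle[of "(2 ^ (i + r) - 1) * x" "2 ^ r * ((2 ^ i - 1) * x)"]
      circ_norm_power2_mult_le[of r "(2 ^ i - 1) * x"] by simp
  also have "circ_norm ((2 ^ (i + r) - 1) * x) \<le> 1 / 2 ^ Suc j"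
    using near_mono[OF assms(2,3)] by (simp add: near_def)
  also have "2 ^ r * circ_norm ((2 ^ i - 1) * x) \<le> 2 ^ r * (1 / 2 ^ (r + Suc j))"
    using near_mono[OF assms(1,4)] by (intro mult_left_mono) (simp_all add: near_def)
  also have "2 ^ r * (1 / 2 ^ (r + Suc j)) = (1 / 2 ^ Suc j :: real)"
    by (simp add: power_add)
  also have "1 / 2 ^ Suc j + 1 / 2 ^ Suc j = (1 / 2 ^ j :: real)" by (simp add: field_simps)
  finally show ?thesis by (simp add: near_def)
qed

text \<open>
  Digits \<open>0, \<dots>, m - 1\<close> split into copies of length at least \<open>K\<close> and at most \<open>u\<close> free digits.
\<close>
inductive parse :: "nat \<Rightarrow> real \<Rightarrow> nat \<Rightarrow> nat \<Rightarrow> bool" for K :: nat and x :: real where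
  start: "parse K x 0 u"
| free: "parse K x m u \<Longrightarrow> parse K x (Suc m) (Suc u)"
| copy: "parse K x i u \<Longrightarrow> 1 \<le> i \<Longrightarrow> K \<le> l \<Longrightarrow> near x i l \<Longrightarrow> parse K x (i + l) u"

lemma parse_mono: "parse K x m u \<Longrightarrow> u \<le> v \<Longrightarrow> parse K x m v"
proof (induction arbitrary: v rule: parse.induct)
  case (free m u)
  then obtain w where "v = Suc w" "u \<le> w" by (cases v) auto
  then show ?case using free.IH parse.free by simp
qed (auto intro: parse.intros)

lemma parse_self: "parse K x m m"
  by (induction m) (auto intro: parse.intros)

section \<open>Counting the dyadic cells of parsed points\<close>

definition parse_cells :: "nat \<Rightarrow> nat \<Rightarrow> nat \<Rightarrow> int set" where
  "parse_cells K m u = (\<lambda>x. \<lfloor>2 ^ m * x\<rfloor>) ` {x \<in> circle. parse K x m u}"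

lemma finite_parse_cells: "finite (parse_cells K m u)"
proof (rule finite_subset)
  show "parse_cells K m u \<subseteq> {0..<2 ^ m}"
  proof
    fix a assume "a \<in> parse_cells K m u"
    then obtain x :: real where x: "a = \<lfloor>2 ^ m * x\<rfloor>" "0 \<le> x" "x < 1"
      by (auto simp: parse_cells_def circle_def)
    have "2 ^ m * x < real_of_int (2 ^ m)" using x by simp
    then show "a \<in> {0..<2 ^ m}" using x by (simp add: floor_less_iff)
  qed
qed simp

lemma floor_double_cases:
  fixes y :: real
  shows "\<lfloor>2 * y\<rfloor> \<in> {2 * \<lfloor>y\<rfloor>, 2 * \<lfloor>y\<rfloor> + 1}"
proof -
  have "2 * \<lfloor>y\<rfloor> \<le> \<lfloor>2 * y\<rfloor>" by (simp add: le_floor_iff)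
  moreover have "\<lfloor>2 * y\<rfloor> < 2 * \<lfloor>y\<rfloor> + 2"
    by (simp add: floor_less_iff) linarith
  ultimately show ?thesis by auto
qed

text \<open>The cells of level \<open>i + l\<close> that a single copy step can reach from the cell
  \<open>a\<close> of level \<open>i\<close>.\<close>

definition copies :: "nat \<Rightarrow> nat \<Rightarrow> int \<Rightarrow> int set" where
  "copies i l a = (\<lambda>x. \<lfloor>2 ^ (i + l) * x\<rfloor>) ` {x. \<lfloor>2 ^ i * x\<rfloor> = a \<and> near x i l}"

text \<open>
  Since \<open>(2 ^ i - 1) x\<close> is known up to 1, it is near at most 4 integers \<open>n\<close>, and each \<open>n\<close> leaves at most 7
  candidates for \<open>\<lfloor>2 ^ (i + l) * x\<rfloor>\<close>.
\<close>
lemma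
  assumes "1 \<le> i"
  shows finite_copies: "finite (copies i l a)" and card_copies_le: "card (copies i l a) \<le> 28"
proof -
  define q :: real where "q = 2 ^ i - 1"
  have two: "(2::real) \<le> 2 ^ i" using assms power_increasing[of 1 i "2::real"] by simp
  \<comment> \<open>As \<open>i \<ge> 1\<close>, \<open>q\<close> is at least half of
    \<open>2 ^ i\<close>; this bounds the error \<open>2 ^ i / q\<close> of the cell index by
    2.\<close>
  then have q1: "1 \<le> q" and q2: "2 ^ i \<le> 2 * q" by (simp_all add: q_def)
  define f where "f = \<lfloor>q * of_int a / 2 ^ i\<rfloor>"
  define c where "c n = \<lfloor>2 ^ (i + l) * of_int n / q\<rfloor>" for n :: int
  let ?U = "\<Union>n\<in>{f - 1..f + 2}. {c n - 3..c n + 3}"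
  have sub: "copies i l a \<subseteq> ?U"
  proof
    fix b assume "b \<in> copies i l a"
    then obtain x where b: "b = \<lfloor>2 ^ (i + l) * x\<rfloor>" and a: "\<lfloor>2 ^ i * x\<rfloor> = a" and nx: "near x i l"
      by (auto simp: copies_def)
    obtain n :: int where n: "\<bar>q * x - of_int n\<bar> \<le> 1 / 2 ^ l"
      using circ_norm_attained[of "q * x"] nx unfolding near_def q_def by auto
    have "of_int a \<le> 2 ^ i * x" "2 ^ i * x < of_int a + 1" using a by linarith+
    then have x: "of_int a / 2 ^ i \<le> x" "x < (of_int a + 1) / 2 ^ i"
      by (simp_all add: field_simps)
    have "q * (of_int a / 2 ^ i) \<le> q * x"
      using x(1) q1 by (intro mult_left_mono) auto
    then have lo: "q * of_int a / 2 ^ i \<le> q * x" by simp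
    have "q * x < q * ((of_int a + 1) / 2 ^ i)"
      using x(2) q1 by (intro mult_strict_left_mono) auto
    also have "\<dots> = q * of_int a / 2 ^ i + q / 2 ^ i" by (simp add: field_simps)
    also have "q / 2 ^ i \<le> 1" by (simp add: q_def)
    finally have hi: "q * x < q * of_int a / 2 ^ i + 1" by simp
    have l1: "1 / 2 ^ l \<le> (1::real)" by simp
    have "n \<in> {f - 1..f + 2}"
      using n lo hi l1 unfolding f_def atLeastAtMost_iff by linarith
    moreover have "b \<in> {c n - 3..c n + 3}"
    proof -
      have "\<bar>2 ^ (i + l) * x - 2 ^ (i + l) * of_int n / q\<bar> = 2 ^ (i + l) / q * \<bar>q * x - of_int n\<bar>"
        using q1 by (simp add: abs_mult[symmetric] abs_divide field_simps)
          (simp add: abs_if field_simps)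
      also have "\<dots> \<le> 2 ^ (i + l) / q * (1 / 2 ^ l)"
        using n q1 by (intro mult_left_mono) auto
      also have "\<dots> = 2 ^ i / q" by (simp add: power_add)
      also have "\<dots> \<le> 2" using q1 q2 by (simp add: field_simps)
      finally show ?thesis unfolding b c_def atLeastAtMost_iff by linarith
    qed
    ultimately show "b \<in> ?U" by blast
  qed
  have "card ?U \<le> (\<Sum>n\<in>{f - 1..f + 2}. card {c n - 3..c n + 3})"
    by (rule card_UN_le) simp
  also have "\<dots> = 28" by simp
  finally show "card (copies i l a) \<le> 28"
    using card_mono[OF _ sub] by auto
  show "finite (copies i l a)" by (rule finite_subset[OF sub]) simp
qed

text \<open>The last rule of the parse yields a recursion in \<open>m\<close>: a free digit splits a
  cell in two, a copy leads into \<open>copies\<close>. A copy starts at a position at least 1, so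
  its length is below \<open>m\<close>.\<close>

lemma parse_cells_subset:
  assumes "0 < m" "1 \<le> K"
  shows "parse_cells K m u \<subseteq>
    (if u = 0 then {} else \<Union>a\<in>parse_cells K (m - 1) (u - 1). {2 * a, 2 * a + 1}) \<union>
    (\<Union>l\<in>{K..<m}. \<Union>a\<in>parse_cells K (m - l) u. copies (m - l) l a)"
    (is "_ \<subseteq> ?F \<union> ?C")
proof
  fix b assume "b \<in> parse_cells K m u"
  then obtain x where x: "x \<in> circle" "parse K x m u" and b: "b = \<lfloor>2 ^ m * x\<rfloor>"
    by (auto simp: parse_cells_def)
  from x(2) show "b \<in> ?F \<union> ?C"
  proof cases
    case start
    then show ?thesis using assms by simp
  next
    case (free m' u')
    have "b = \<lfloor>2 * (2 ^ m' * x)\<rfloor>" using free b by (simp add: mult.assoc)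
    then have "b \<in> {2 * \<lfloor>2 ^ m' * x\<rfloor>, 2 * \<lfloor>2 ^ m' * x\<rfloor> + 1}"
      using floor_double_cases by metis
    moreover have "\<lfloor>2 ^ m' * x\<rfloor> \<in> parse_cells K (m - 1) (u - 1)"
      using free x(1) by (auto simp: parse_cells_def)
    ultimately show ?thesis using free(2) by auto
  next
    case (copy i l)
    then have "\<lfloor>2 ^ i * x\<rfloor> \<in> parse_cells K (m - l) u" "b \<in> copies (m - l) l \<lfloor>2 ^ i * x\<rfloor>" "l \<in> {K..<m}"
      using x(1) b by (auto simp: parse_cells_def copies_def)
    then show ?thesis by blast
  qed
qed

text \<open>Each digit is given weight \<open>\<beta>\<close> and each free digit a further weight
  4. A free digit produces only 2 cells, so it uses at most half of the bound. A copy of length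
  \<open>l\<close> produces 28 cells but saves \<open>\<beta> ^ l\<close>; by \<open>small\<close>
  all lengths together use the other half.\<close>

lemma card_parse_cells_le:
  fixes \<beta> :: real
  assumes K: "1 \<le> K" and \<beta>: "1 \<le> \<beta>" and small: "\<And>m. (\<Sum>l\<in>{K..<m}. 28 / \<beta> ^ l) \<le> 1 / 2"
  shows "real (card (parse_cells K m u)) \<le> \<beta> ^ m * 4 ^ u"
proof (induction m arbitrary: u rule: less_induct)
  case (less m)
  show ?case
  proof (cases "m = 0")
    case True
    have "parse_cells K 0 u \<subseteq> {0}" by (auto simp: parse_cells_def circle_def floor_eq_iff)
    then have "card (parse_cells K 0 u) \<le> card {0::int}" by (intro card_mono) auto
    then have "real (card (parse_cells K 0 u)) \<le> 1" by simp
    also have "(1::real) \<le> 4 ^ u" by simp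
    finally show ?thesis using True by simp
  next
    case False
    let ?F = "if u = 0 then {} else \<Union>a\<in>parse_cells K (m - 1) (u - 1). {2 * a, 2 * a + 1}"
    let ?C = "\<lambda>l. \<Union>a\<in>parse_cells K (m - l) u. copies (m - l) l a"
    have F: "real (card ?F) \<le> \<beta> ^ m * 4 ^ u / 2"
    proof (cases "u = 0")
      case u: False
      have "card ?F \<le> (\<Sum>a\<in>parse_cells K (m - 1) (u - 1). card {2 * a, 2 * a + 1})"
        using u card_UN_le[OF finite_parse_cells, where A = "\<lambda>a. {2 * a, 2 * a + 1}"]
        by simp_all
      also have "\<dots> = 2 * card (parse_cells K (m - 1) (u - 1))" by simp
      finally have "real (card ?F) \<le> 2 * (\<beta> ^ (m - 1) * 4 ^ (u - 1))"
        using less.IH[of "m - 1" "u - 1"] False by simp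
      also have "2 * (\<beta> ^ (m - 1) * 4 ^ (u - 1)) = \<beta> ^ (m - 1) * (4 ^ u / 2)"
        using u by (cases u) simp_all
      also have "\<dots> \<le> \<beta> ^ m * (4 ^ u / 2)"
        using \<beta> by (intro mult_right_mono power_increasing) auto
      finally show ?thesis by simp
    qed (use \<beta> in simp)
    have C: "real (card (?C l)) \<le> \<beta> ^ m * 4 ^ u * (28 / \<beta> ^ l)" if l: "l \<in> {K..<m}" for l
    proof -
      have "card (?C l) \<le> (\<Sum>a\<in>parse_cells K (m - l) u. card (copies (m - l) l a))"
        by (rule card_UN_le[OF finite_parse_cells])
      also have "\<dots> \<le> (\<Sum>a\<in>parse_cells K (m - l) u. 28)"
        using l by (intro sum_mono card_copies_le) (simp, linarith)
      finally have "real (card (?C l)) \<le> 28 * real (card (parse_cells K (m - l) u))" by simp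
      also have "\<dots> \<le> 28 * (\<beta> ^ (m - l) * 4 ^ u)"
        using l K less.IH[of "m - l" u] by (intro mult_left_mono) auto
      also have "\<beta> ^ (m - l) = \<beta> ^ m / \<beta> ^ l" using l \<beta> by (intro power_diff) auto
      finally show ?thesis by (simp add: field_simps)
    qed
    have "finite ?F" using finite_parse_cells by simp
    moreover have "finite (?C l)" if "l \<in> {K..<m}" for l
    proof (rule finite_UN_I[OF finite_parse_cells])
      have "1 \<le> m - l" using that by simp linarith
      then show "finite (copies (m - l) l a)" for a by (rule finite_copies)
    qed
    then have "finite (\<Union>l\<in>{K..<m}. ?C l)" by (rule finite_UN_I[OF finite_atLeastLessThan])
    ultimately have fin: "finite (?F \<union> (\<Union>l\<in>{K..<m}. ?C l))" by (rule finite_UnI)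
    have "card (parse_cells K m u) \<le> card (?F \<union> (\<Union>l\<in>{K..<m}. ?C l))"
      using False K by (intro card_mono fin parse_cells_subset) auto
    also have "\<dots> \<le> card ?F + card (\<Union>l\<in>{K..<m}. ?C l)" by (rule card_Un_le)
    also have "card (\<Union>l\<in>{K..<m}. ?C l) \<le> (\<Sum>l\<in>{K..<m}. card (?C l))"
      by (rule card_UN_le) simp
    finally have "card (parse_cells K m u) \<le> card ?F + (\<Sum>l\<in>{K..<m}. card (?C l))" by simp
    then have "real (card (parse_cells K m u)) \<le> real (card ?F) + (\<Sum>l\<in>{K..<m}. real (card (?C l)))"
      unfolding of_nat_sum[symmetric] of_nat_add[symmetric] of_nat_le_iff .
    also have "\<dots> \<le> \<beta> ^ m * 4 ^ u / 2 + (\<Sum>l\<in>{K..<m}. \<beta> ^ m * 4 ^ u * (28 / \<beta> ^ l))"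
      by (intro add_mono sum_mono F C)
    also have "(\<Sum>l\<in>{K..<m}. \<beta> ^ m * 4 ^ u * (28 / \<beta> ^ l)) = \<beta> ^ m * 4 ^ u * (\<Sum>l\<in>{K..<m}. 28 / \<beta> ^ l)"
      by (simp only: sum_distrib_left)
    also have "\<dots> \<le> \<beta> ^ m * 4 ^ u * (1 / 2)"
      using \<beta> by (intro mult_left_mono small) auto
    finally show ?thesis by simp
  qed
qed

subsection \<open>Hausdorff measure of limsup sets\<close>

lemma dT_nonneg: "0 \<le> dT x y"
  by (simp add: dT_def circ_norm_nonneg)

lemma diamT_nonneg: "0 \<le> diamT S"
proof (cases "S = {}")
  case False
  then obtain z where "z \<in> S" by blast
  \<comment> \<open>A supremum of reals is an upper bound only for a set that is bounded above;
    circle distances never exceed 1.\<close>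
  have "dT x y \<le> 1" for x y
    using circ_norm_attained[of "x - y"] circ_norm_le[of "x - y" "\<lfloor>x - y\<rfloor>"]
    unfolding dT_def by linarith
  then have "bdd_above {dT x y |x y. x \<in> S \<and> y \<in> S}" by (auto intro!: bdd_aboveI)
  then have "dT z z \<le> Sup {dT x y |x y. x \<in> S \<and> y \<in> S}"
    using \<open>z \<in> S\<close> by (intro cSup_upper) auto
  then show ?thesis using dT_nonneg[of z z] False by (simp add: diamT_def)
qed (simp add: diamT_def)

lemma diamT_le:
  assumes "\<And>x y. x \<in> S \<Longrightarrow> y \<in> S \<Longrightarrow> \<bar>x - y\<bar> \<le> r" "0 \<le> r"
  shows "diamT S \<le> r"
proof (cases "S = {}")
  case False
  have le: "dT x y \<le> r" if "x \<in> S" "y \<in> S" for x y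
    using circ_norm_le_abs[of "x - y"] assms(1)[OF that] by (simp add: dT_def)
  have "Sup {dT x y |x y. x \<in> S \<and> y \<in> S} \<le> r"
  proof (rule cSup_least)
    show "{dT x y |x y. x \<in> S \<and> y \<in> S} \<noteq> {}" using False by blast
  qed (use le in auto)
  then show ?thesis using False by (simp add: diamT_def)
qed (use assms in \<open>simp add: diamT_def\<close>)

lemma diam_pow_le:
  assumes "0 < s" "diamT S \<le> r"
  shows "diam_pow s S \<le> ennreal (r powr s)"
  using assms diamT_nonneg[of S] by (auto simp: diam_pow_def intro!: ennreal_leI powr_mono2)

definition dyadic :: "nat \<Rightarrow> int \<Rightarrow> real set" where
  "dyadic m a = {x \<in> circle. \<lfloor>2 ^ m * x\<rfloor> = a}"

lemma diamT_dyadic: "diamT (dyadic m a) \<le> 1 / 2 ^ m"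
proof (rule diamT_le)
  fix x y assume "x \<in> dyadic m a" "y \<in> dyadic m a"
  then have "\<bar>2 ^ m * x - 2 ^ m * y\<bar> \<le> 1" unfolding dyadic_def by simp linarith
  then have "2 ^ m * \<bar>x - y\<bar> \<le> 1" by (simp add: right_diff_distrib[symmetric] abs_mult)
  then show "\<bar>x - y\<bar> \<le> 1 / 2 ^ m" by (simp add: field_simps)
qed simp

text \<open>The cells of all levels from \<open>N\<close> on cover \<open>A\<close>. Level
  \<open>m\<close> contributes at most \<open>2 powr (s / 2 * m)\<close> terms of size
  \<open>2 powr (- s * m)\<close>, so the total is the tail of a convergent geometric
  series.\<close>

lemma hausdorff_measure_limsup_zero:
  fixes V :: "nat \<Rightarrow> int set"
  assumes s: "0 < s" and fin: "\<And>m. finite (V m)"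
    and card: "\<And>m. real (card (V m)) \<le> 2 powr (s / 2 * real m)"
    and cov: "\<And>N x. x \<in> A \<Longrightarrow> x \<in> circle \<and> (\<exists>m\<ge>N. \<lfloor>2 ^ m * x\<rfloor> \<in> V m)"
  shows "hausdorff_measure s A = 0"
proof -
  have pre: "hausdorff_pre s \<delta> A \<le> ennreal \<eta>" if \<delta>: "0 < \<delta>" and \<eta>: "0 < \<eta>" for \<delta> \<eta>
  proof -
    define q :: real where "q = 2 powr (- s / 2)"
    have q: "0 < q" "q < 1" using s by (auto simp: q_def powr_less_one)
    have "(\<lambda>N. q ^ N / (1 - q)) \<longlonglongrightarrow> 0 / (1 - q)"
      using q by (intro tendsto_divide LIMSEQ_realpow_zero tendsto_const) auto
    then have "\<forall>\<^sub>F N in sequentially. q ^ N / (1 - q) < \<eta>"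
      using \<eta> by (intro order_tendstoD) auto
    moreover have "(\<lambda>N. (1 / 2 :: real) ^ N) \<longlonglongrightarrow> 0" by (rule LIMSEQ_realpow_zero) auto
    then have "\<forall>\<^sub>F N in sequentially. (1 / 2) ^ N < \<delta>"
      using \<delta> by (rule order_tendstoD)
    ultimately have "\<forall>\<^sub>F N in sequentially. q ^ N / (1 - q) < \<eta> \<and> (1 / 2) ^ N < \<delta>"
      by (rule eventually_conj)
    then obtain N where N: "q ^ N / (1 - q) < \<eta>" "(1 / 2) ^ N < \<delta>"
      using eventually_happens by fastforce
    define D where "D p = (case p of (m, n) \<Rightarrow>
      if int n \<in> V (m + N) then dyadic (m + N) (int n) else {})" for p
    define C where "C i = D (prod_decode i)" for i
    have cover: "A \<subseteq> (\<Union>i. C i)"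
    proof
      fix x assume "x \<in> A"
      then obtain m where m: "x \<in> circle" "N \<le> m" "\<lfloor>2 ^ m * x\<rfloor> \<in> V m" using cov by blast
      \<comment> \<open>Natural numbers suffice as cell indices, because points of the circle are
        nonnegative.\<close>
      have "0 \<le> \<lfloor>2 ^ m * x\<rfloor>" using m(1) by (simp add: circle_def)
      then have "x \<in> D (m - N, nat \<lfloor>2 ^ m * x\<rfloor>)"
        using m by (simp add: D_def dyadic_def)
      then have "x \<in> C (prod_encode (m - N, nat \<lfloor>2 ^ m * x\<rfloor>))" by (simp add: C_def)
      then show "x \<in> (\<Union>i. C i)" by blast
    qed
    have diam: "diamT (C i) \<le> \<delta>" for i
    proof -
      obtain m n where mn: "prod_decode i = (m, n)" by fastforce
      have "1 / 2 ^ (m + N) \<le> (1 / 2 :: real) ^ N" by (simp add: power_one_over frac_le)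
      then show ?thesis
        using diamT_dyadic[of "m + N" "int n"] N(2) \<delta>
        by (auto simp: C_def D_def mn diamT_def[of "{}"])
    qed
    have sub: "C i \<subseteq> circle" for i by (auto simp: C_def D_def dyadic_def split: prod.splits)
    have inner: "(\<Sum>n. diam_pow s (D (m, n))) \<le> ennreal (q ^ (m + N))" for m
    proof -
      let ?M = "m + N"
      have fin': "finite (nat ` V ?M)" using fin by simp
      have zero: "diam_pow s (D (m, n)) = 0" if "n \<notin> nat ` V ?M" for n
        using that by (force simp: D_def diam_pow_def image_iff)
      have le: "diam_pow s (D (m, n)) \<le> ennreal (2 powr (- s * real ?M))" for n
      proof -
        have "diam_pow s (dyadic ?M (int n)) \<le> ennreal ((1 / 2 ^ ?M) powr s)"
          by (rule diam_pow_le[OF s diamT_dyadic])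
        also have "(1 / 2 ^ ?M) powr s = 2 powr (- s * real ?M)"
          by (simp add: powr_divide powr_minus_divide powr_powr mult.commute flip: powr_realpow)
        finally show ?thesis by (simp add: D_def diam_pow_def[of _ "{}"])
      qed
      have "(\<Sum>n. diam_pow s (D (m, n))) = (\<Sum>n\<in>nat ` V ?M. diam_pow s (D (m, n)))"
        by (rule suminf_finite[OF fin' zero])
      also have "\<dots> \<le> (\<Sum>n\<in>nat ` V ?M. ennreal (2 powr (- s * real ?M)))"
        by (intro sum_mono le)
      also have "\<dots> = ennreal (real (card (nat ` V ?M)) * 2 powr (- s * real ?M))"
        by (simp add: ennreal_mult ennreal_of_nat_eq_real_of_nat)
      also have "\<dots> \<le> ennreal (2 powr (s / 2 * real ?M) * 2 powr (- s * real ?M))"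
        using card[of ?M] card_image_le[OF fin, of nat ?M]
        by (intro ennreal_leI mult_right_mono) auto
      also have "2 powr (s / 2 * real ?M) * 2 powr (- s * real ?M) = q ^ ?M"
      proof -
        have "q ^ ?M = 2 powr (- s / 2 * real ?M)"
          unfolding q_def by (simp only: powr_powr powr_realpow[symmetric] powr_gt_zero)
        also have "- s / 2 * real ?M = s / 2 * real ?M + - s * real ?M" by (simp add: field_simps)
        finally show ?thesis by (simp only: powr_add)
      qed
      finally show ?thesis .
    qed
    have geo: "(\<lambda>m. q ^ (m + N)) sums (q ^ N / (1 - q))"
      using sums_mult[OF geometric_sums[of q], of "q ^ N"] q by (simp add: power_add mult.commute)
    have "(\<Sum>i. diam_pow s (C i)) = (\<Sum>m. \<Sum>n. diam_pow s (D (m, n)))"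
      unfolding C_def
      by (rule suminf_ennreal_2dimen[where f = "\<lambda>p. diam_pow s (D p)"]) simp
    also have "\<dots> \<le> (\<Sum>m. ennreal (q ^ (m + N)))"
      by (intro suminf_le inner) auto
    also have "\<dots> = ennreal (q ^ N / (1 - q))"
      using geo q by (intro sums_unique[symmetric]) (simp add: sums_ennreal)
    also have "\<dots> \<le> ennreal \<eta>" using N by (intro ennreal_leI) simp
    finally have "(\<Sum>i. diam_pow s (C i)) \<le> ennreal \<eta>" .
    moreover have "hausdorff_pre s \<delta> A \<le> (\<Sum>i. diam_pow s (C i))"
      unfolding hausdorff_pre_def using cover diam sub by (intro INF_lower) simp
    ultimately show ?thesis by (rule order_trans[rotated])
  qed
  have "hausdorff_pre s \<delta> A \<le> 0" if "0 < \<delta>" for \<delta>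
  proof (rule ennreal_le_epsilon)
    show "hausdorff_pre s \<delta> A \<le> 0 + ennreal \<eta>" if "0 < \<eta>" for \<eta>
      using pre[OF \<open>0 < \<delta>\<close> that] by simp
  qed
  then have "hausdorff_measure s A \<le> 0"
    unfolding hausdorff_measure_def by (intro SUP_least) simp
  then show ?thesis by simp
qed

lemma hausdorff_dim_eq_0:
  assumes "\<And>s. 0 < s \<Longrightarrow> hausdorff_measure s A = 0"
  shows "hausdorff_dim A = 0"
proof (rule antisym)
  show "hausdorff_dim A \<le> 0"
  proof (rule ereal_le_epsilon2)
    fix e :: real assume "0 < e"
    then show "hausdorff_dim A \<le> 0 + ereal e"
      unfolding hausdorff_dim_def using assms[of e] by (auto intro!: Inf_lower)
  qed
  show "0 \<le> hausdorff_dim A"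
    unfolding hausdorff_dim_def by (auto intro!: Inf_greatest)
qed

section \<open>Points parsed with few free digits at infinitely many lengths\<close>

lemma geometric_tail_small:
  fixes \<beta> :: real
  assumes "1 < \<beta>"
  obtains K where "1 \<le> K" "\<And>m. (\<Sum>l\<in>{K..<m}. 28 / \<beta> ^ l) \<le> 1 / 2"
proof -
  define q where "q = 1 / \<beta>"
  have q: "0 < q" "q < 1" using assms by (auto simp: q_def)
  have "(\<lambda>N. 28 * (q ^ N / (1 - q))) \<longlonglongrightarrow> 28 * (0 / (1 - q))"
    using q by (intro tendsto_mult tendsto_divide LIMSEQ_realpow_zero tendsto_const) auto
  then have "\<forall>\<^sub>F N in sequentially. 28 * (q ^ N / (1 - q)) < 1 / 2"
    by (intro order_tendstoD) auto
  then obtain N where N: "\<And>n. n \<ge> N \<Longrightarrow> 28 * (q ^ n / (1 - q)) < 1 / 2"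
    by (auto simp: eventually_sequentially)
  define K where "K = max 1 N"
  have "(\<Sum>l\<in>{K..<m}. 28 / \<beta> ^ l) \<le> 1 / 2" for m
  proof (cases "K \<le> m")
    case True
    have "(\<Sum>l\<in>{K..<m}. 28 / \<beta> ^ l) = 28 * (\<Sum>l\<in>{K..<m}. q ^ l)"
      by (simp add: sum_distrib_left q_def power_one_over)
    also have "(\<Sum>l\<in>{K..<m}. q ^ l) = (q ^ K - q ^ m) / (1 - q)"
    proof -
      have "(1 - q) * (\<Sum>l\<in>{K..<m}. q ^ l) = (\<Sum>l\<in>{K..<m}. - (q ^ Suc l) - - (q ^ l))"
        by (simp add: sum_distrib_left algebra_simps)
      also have "\<dots> = q ^ K - q ^ m" using sum_Suc_diff'[OF True, of "\<lambda>l. - (q ^ l)"] by simp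
      finally show ?thesis using q by (simp add: field_simps)
    qed
    also have "\<dots> \<le> q ^ K / (1 - q)" using q by (intro divide_right_mono) auto
    finally show ?thesis using N[of K] by (simp add: K_def)
  qed simp
  moreover have "1 \<le> K" by (simp add: K_def)
  ultimately show ?thesis using that by blast
qed

text \<open>With \<open>\<beta> = 2 powr (s / 4)\<close> and at most \<open>s / 8 * m\<close> free
  digits, both factors of \<open>\<beta> ^ m * 4 ^ u\<close> are at most
  \<open>2 powr (s / 4 * m)\<close>. Their product is the growth that the covering argument allows.
  The minimal copy length \<open>K\<close> makes the geometric tail small.\<close>

lemma hausdorff_measure_parse_limsup:
  fixes s :: real
  assumes "0 < s"
  obtains K where "1 \<le> K"
    "hausdorff_measure s {x \<in> circle. \<forall>N. \<exists>m\<ge>N. parse K x m (nat \<lfloor>s / 8 * real m\<rfloor>)} = 0"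
proof -
  define \<beta> :: real where "\<beta> = 2 powr (s / 4)"
  have \<beta>: "1 < \<beta>" using assms by (simp add: \<beta>_def)
  then obtain K where K: "1 \<le> K" "\<And>m. (\<Sum>l\<in>{K..<m}. 28 / \<beta> ^ l) \<le> 1 / 2"
    using geometric_tail_small by blast
  define V where "V m = parse_cells K m (nat \<lfloor>s / 8 * real m\<rfloor>)" for m
  have "hausdorff_measure s {x \<in> circle. \<forall>N. \<exists>m\<ge>N. parse K x m (nat \<lfloor>s / 8 * real m\<rfloor>)} = 0"
  proof (rule hausdorff_measure_limsup_zero[OF assms, where V = V])
    fix m
    let ?u = "nat \<lfloor>s / 8 * real m\<rfloor>"
    have "real (card (V m)) \<le> \<beta> ^ m * 4 ^ ?u"
      unfolding V_def using K \<beta> by (intro card_parse_cells_le) auto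
    also have "\<beta> ^ m = 2 powr (s / 4 * real m)"
      unfolding \<beta>_def by (simp only: powr_powr powr_realpow[symmetric] powr_gt_zero)
    also have "(4::real) ^ ?u = 2 powr (2 * real ?u)"
      using powr_realpow[of "2::real" "2 * ?u"] by (simp add: power_mult)
    also have "\<dots> \<le> 2 powr (s / 4 * real m)"
    proof -
      have "real ?u \<le> s / 8 * real m" using assms by (intro of_nat_floor) simp
      then show ?thesis by simp
    qed
    finally show "real (card (V m)) \<le> 2 powr (s / 2 * real m)"
      by (simp flip: powr_add)
  next
    show "finite (V m)" for m by (simp add: V_def finite_parse_cells)
  next
    fix N x assume "x \<in> {x \<in> circle. \<forall>N. \<exists>m\<ge>N. parse K x m (nat \<lfloor>s / 8 * real m\<rfloor>)}"
    then obtain m where "N \<le> m" "x \<in> circle" "parse K x m (nat \<lfloor>s / 8 * real m\<rfloor>)" by blast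
    then show "x \<in> circle \<and> (\<exists>m\<ge>N. \<lfloor>2 ^ m * x\<rfloor> \<in> V m)"
      unfolding V_def parse_cells_def by blast
  qed
  then show ?thesis using that K(1) by blast
qed

subsection \<open>Counting close returns\<close>

text \<open>Greedy selection: take an element of maximal size, discard everything that meets it, and
  repeat. Whatever is discarded meets a chosen element that is at least as large.\<close>

lemma finite_vitali:
  fixes I :: "'a \<Rightarrow> 'b set" and size :: "'a \<Rightarrow> nat"
  assumes "finite S" "\<And>p. p \<in> S \<Longrightarrow> I p \<noteq> {}"
  shows "\<exists>F\<subseteq>S. disjoint_family_on I F \<and> (\<forall>p\<in>S. \<exists>q\<in>F. size p \<le> size q \<and> I p \<inter> I q \<noteq> {})"
  using assms
proof (induction "card S" arbitrary: S rule: less_induct)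
  case less
  show ?case
  proof (cases "S = {}")
    case False
    obtain q where q: "q \<in> S" "\<And>p. p \<in> S \<Longrightarrow> size p \<le> size q"
    proof -
      have "Max (size ` S) \<in> size ` S" using less.prems(1) False by simp
      then obtain q where "q \<in> S" "size q = Max (size ` S)" by auto
      then show ?thesis using that less.prems(1) by simp
    qed
    let ?S = "{p \<in> S. I p \<inter> I q = {}}"
    \<comment> \<open>Nonemptiness of \<open>I q\<close> makes \<open>q\<close> meet itself, so the
      remaining set is strictly smaller.\<close>
    have "q \<notin> ?S" using q less.prems(2) by auto
    then have "card ?S < card S" using q(1) less.prems(1) by (intro psubset_card_mono) auto
    then obtain F where F: "F \<subseteq> ?S" "disjoint_family_on I F"
      "\<forall>p\<in>?S. \<exists>q\<in>F. size p \<le> size q \<and> I p \<inter> I q \<noteq> {}"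
      using less.hyps[of ?S] less.prems by auto
    have "insert q F \<subseteq> S" using F(1) q(1) by auto
    moreover have "disjoint_family_on I (insert q F)"
      using F(1,2) by (fastforce simp: disjoint_family_on_def)
    moreover have "\<exists>r\<in>insert q F. size p \<le> size r \<and> I p \<inter> I r \<noteq> {}" if "p \<in> S" for p
      using F(3) q(2)[OF that] that by (cases "I p \<inter> I q = {}") auto
    ultimately show ?thesis by blast
  qed (simp add: disjoint_family_on_def)
qed

section \<open>Disjoint blocks as parses\<close>

definition block :: "nat \<times> nat \<Rightarrow> nat set" where
  "block p = {fst p..<fst p + snd p}"

lemma sum_block_le:
  assumes "disjoint_family_on block F" "\<And>p. p \<in> F \<Longrightarrow> block p \<subseteq> {..<m}" "finite F"
  shows "(\<Sum>p\<in>F. snd p) \<le> m"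
proof -
  have "card (\<Union>p\<in>F. block p) = (\<Sum>p\<in>F. card (block p))"
    by (rule card_UN_disjoint'[OF assms(1) _ assms(3)]) (simp add: block_def)
  moreover have "card (\<Union>p\<in>F. block p) \<le> card {..<m}"
    using assms by (intro card_mono) auto
  ultimately show ?thesis by (simp add: block_def)
qed

text \<open>The prefix is read from its right end. A block ending at \<open>m\<close> becomes the
  last copy; otherwise the last digit is free. Thus the free digits are exactly those outside all
  blocks.\<close>

lemma parse_of_blocks:
  assumes "finite F" "disjoint_family_on block F" "1 \<le> K"
    "\<And>i l. (i, l) \<in> F \<Longrightarrow> 1 \<le> i \<and> K \<le> l \<and> near x i l \<and> i + l \<le> m"
  shows "parse K x m (m - (\<Sum>p\<in>F. snd p))"
  using assms
proof (induction m arbitrary: F rule: less_induct)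
  case (less m)
  show ?case
  proof (cases "\<exists>i l. (i, l) \<in> F \<and> i + l = m")
    case True
    then obtain i l where il: "(i, l) \<in> F" "i + l = m" by blast
    let ?F = "F - {(i, l)}"
    have l: "1 \<le> i" "K \<le> l" "near x i l" using less.prems(4) il by auto
    \<comment> \<open>Every other block lies to the left of \<open>i\<close>: otherwise the position
      \<open>max i j\<close> would belong to both blocks.\<close>
    have "j + k \<le> i" if "(j, k) \<in> ?F" for j k
    proof -
      have "block (j, k) \<inter> block (i, l) = {}"
        using less.prems(2) that il(1) by (auto simp: disjoint_family_on_def)
      moreover have "K \<le> k" "j + k \<le> m" using less.prems(4) that by auto
      ultimately show ?thesis
        using l il(2) less.prems(3)
        by (cases "j + k \<le> i") (auto simp: block_def disjoint_iff dest!: spec[of _ "max i j"])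
    qed
    moreover have "disjoint_family_on block ?F"
      using less.prems(2) by (auto simp: disjoint_family_on_def)
    moreover have "i < m" using l less.prems(3) il(2) by simp
    ultimately have "parse K x i (i - (\<Sum>p\<in>?F. snd p))"
      using less.prems by (intro less.IH) auto
    then have "parse K x (i + l) (i - (\<Sum>p\<in>?F. snd p))" using l by (rule parse.copy)
    moreover have "(\<Sum>p\<in>F. snd p) = l + (\<Sum>p\<in>?F. snd p)"
      using sum.remove[OF less.prems(1) il(1), of snd] by simp
    ultimately show ?thesis by (simp flip: il(2))
  next
    case False
    show ?thesis
    proof (cases m)
      case 0
      then show ?thesis by (simp add: parse.start)
    next
      case (Suc n)
      have le: "i + l \<le> n" if "(i, l) \<in> F" for i l
        using less.prems(4)[OF that] False that Suc by (metis le_SucE)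
      then have "parse K x n (n - (\<Sum>p\<in>F. snd p))"
        using less.prems Suc by (intro less.IH) auto
      then have "parse K x (Suc n) (Suc (n - (\<Sum>p\<in>F. snd p)))" by (rule parse.free)
      \<comment> \<open>This makes the natural subtraction exact, so that \<open>Suc\<close> may be
        moved inside.\<close>
      moreover have "(\<Sum>p\<in>F. snd p) \<le> n"
        using less.prems le by (intro sum_block_le) (force simp: block_def)+
      ultimately show ?thesis using Suc by (simp add: Suc_diff_le)
    qed
  qed
qed

section \<open>Linear growth of the number of returns\<close>

definition returns :: "real \<Rightarrow> nat \<Rightarrow> nat \<Rightarrow> (nat \<times> nat) set" where
  "returns x K m = {(i, k). 1 \<le> i \<and> K \<le> k \<and> i + k \<le> m \<and> near x i k}"

lemma finite_returns: "finite (returns x K m)"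
  by (rule finite_subset[of _ "{..m} \<times> {..m}"]) (auto simp: returns_def)

text \<open>The points lie in a window of length \<open>k\<close> to the left of \<open>e\<close>.
  Cutting it into \<open>q\<close> pieces of length \<open>k / q\<close> leaves at most one point in
  each; \<open>?f\<close> is the number of the piece.\<close>

lemma card_separated_le:
  fixes S :: "nat set"
  assumes "0 < q" "\<And>i. i \<in> S \<Longrightarrow> i < e \<and> e < i + k"
    and sep: "\<And>i j. i \<in> S \<Longrightarrow> j \<in> S \<Longrightarrow> i < j \<Longrightarrow> k \<le> q * (j - i)"
  shows "card S \<le> q"
proof (cases "S = {}")
  case False
  then have k: "0 < k" using assms(2) by fastforce
  let ?f = "\<lambda>i. q * (i - (e - k)) div k"
  have less: "?f i < ?f j" if "i \<in> S" "j \<in> S" "i < j" for i j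
  proof -
    have "q * (i - (e - k)) + k \<le> q * (i - (e - k)) + q * (j - i)" using sep[OF that] by simp
    also have "\<dots> = q * (i - (e - k) + (j - i))" by (rule add_mult_distrib2[symmetric])
    also have "i - (e - k) + (j - i) = j - (e - k)"
      using assms(2)[OF that(1)] that(3) by linarith
    finally have "(q * (i - (e - k)) + k) div k \<le> ?f j" by (rule div_le_mono)
    then show ?thesis using k by simp
  qed
  have "inj_on ?f S"
    by (rule inj_onI) (metis less less_irrefl linorder_neqE_nat)
  moreover have "?f ` S \<subseteq> {..<q}"
  proof (rule image_subsetI)
    fix i assume "i \<in> S"
    then have i: "i - (e - k) < k" using assms(2) by fastforce
    then show "?f i \<in> {..<q}" using k assms(1) by (simp add: less_mult_imp_div_less)
  qed
  ultimately show ?thesis using card_inj_on_le[of ?f S "{..<q}"] by simp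
qed simp

text \<open>The situation of a point that is not parsed cheaply. The bound on \<open>K\<close>
  absorbs the constant \<open>B\<close>: for \<open>k \<ge> K\<close>, the term \<open>B + 1\<close>
  is at most half of \<open>k\<close>.\<close>

locale slow_returns =
  fixes x :: real and C B K :: nat
  assumes near_le: "\<And>i k. 1 \<le> i \<Longrightarrow> near x i k \<Longrightarrow> k \<le> C * i + B"
    and K_large: "2 * (B + 1) \<le> K"
begin

text \<open>Overlapping occurrences of a prefix make it periodic, and small periods are excluded by \<open>near_le\<close>.\<close>
lemma near_gap:
  assumes "K \<le> k" "near x i k" "near x j k" "i < j" "j < i + k"
  shows "k \<le> 2 * (C + 1) * (j - i)"
proof -
  obtain r where r: "j = i + r" "0 < r" "r < k"
    using assms(4,5) by (metis less_imp_add_positive nat_add_left_cancel_less)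
  have "near x r (k - r - 1)"
    by (rule near_shift[OF assms(2), of r k]) (use assms(3) r in auto)
  then have "k - r - 1 \<le> C * r + B" using r(2) by (intro near_le) auto
  then have "k \<le> (C + 1) * r + (B + 1)" by (simp add: le_diff_conv)
  moreover have "2 * (B + 1) \<le> k" using K_large assms(1) by linarith
  moreover have "k \<le> 2 * a" if "k \<le> a + b" "2 * b \<le> k" for a b :: nat
    using that by linarith
  ultimately have "k \<le> 2 * ((C + 1) * r)" by blast
  then show ?thesis using r(1) by (simp add: mult.assoc)
qed

text \<open>For fixed \<open>k\<close> the starting positions lie in a window of length
  \<open>k\<close>, and by \<open>near_gap\<close> they are \<open>k / (2 * (C + 1))\<close> apart.
  This leaves at most \<open>2 * (C + 1)\<close> of them for each of at most \<open>l\<close> values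
  of \<open>k\<close>.\<close>

lemma card_straddling_le:
  "card {(i, k) \<in> returns x K m. k \<le> l \<and> i < e \<and> e < i + k} \<le> 2 * (C + 1) * l"
proof -
  let ?S = "\<lambda>k. {i. 1 \<le> i \<and> i < e \<and> e < i + k \<and> near x i k}"
  have fin: "finite (?S k)" for k by (rule finite_subset[of _ "{..e}"]) auto
  have "card {(i, k) \<in> returns x K m. k \<le> l \<and> i < e \<and> e < i + k}
      \<le> card (\<Union>k\<in>{K..l}. ?S k \<times> {k})"
    using fin by (intro card_mono) (auto simp: returns_def)
  also have "\<dots> \<le> (\<Sum>k\<in>{K..l}. card (?S k \<times> {k}))" by (rule card_UN_le) simp
  also have "\<dots> \<le> (\<Sum>k\<in>{K..l}. 2 * (C + 1))"
  proof (rule sum_mono)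
    fix k assume "k \<in> {K..l}"
    then have "card (?S k) \<le> 2 * (C + 1)"
      by (intro card_separated_le[of _ _ e k] near_gap) auto
    then show "card (?S k \<times> {k}) \<le> 2 * (C + 1)" by (simp add: card_cartesian_product)
  qed
  also have "\<dots> = (Suc l - K) * (2 * (C + 1))"
    by (simp only: sum_constant card_atLeastAtMost of_nat_id)
  also have "\<dots> \<le> l * (2 * (C + 1))" using K_large by (intro mult_le_mono1) simp
  finally show ?thesis by (simp only: mult.commute)
qed

text \<open>
  The triangle inequality costs one unit of \<open>k\<close> when a return is moved from the copy to the prefix;
  the pairs lost at \<open>k = K\<close> account for the summand \<open>l\<close>.
\<close>
lemma card_inside_le:
  assumes "near x j l"
  shows "card {(i, k) \<in> returns x K m. j < i \<and> i + k \<le> j + l} \<le> card (returns x K l) + l"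
proof -
  let ?S = "{(i, k) \<in> returns x K m. j < i \<and> i + k \<le> j + l}"
  let ?f = "\<lambda>(i, k). (i - j, k - 1)"
  have "inj_on ?f ?S" using K_large by (auto simp: inj_on_def returns_def)
  moreover have "?f ` ?S \<subseteq> returns x K l \<union> {1..l} \<times> {K - 1}"
  proof (rule image_subsetI)
    fix p assume "p \<in> ?S"
    then obtain i k where p: "p = (i, k)" "j < i" "i + k \<le> j + l" "K \<le> k" "near x i k"
      by (auto simp: returns_def)
    then have "near x (i - j) (k - 1)"
      using K_large by (intro near_shift[OF assms, of "i - j" k]) simp_all
    moreover have "1 \<le> i - j" "i - j + (k - 1) \<le> l" "i - j \<le> l" "k = K \<or> K \<le> k - 1"
      using p K_large by linarith+
    ultimately show "?f p \<in> returns x K l \<union> {1..l} \<times> {K - 1}"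
      by (auto simp: p(1) returns_def)
  qed
  ultimately have "card ?S \<le> card (returns x K l \<union> {1..l} \<times> {K - 1})"
    by (rule card_inj_on_le) (simp add: finite_returns)
  also have "\<dots> \<le> card (returns x K l) + card ({1..l} \<times> {K - 1})" by (rule card_Un_le)
  finally show ?thesis by (simp add: card_cartesian_product)
qed

text \<open>A return meeting the block crosses its start, crosses its end, starts exactly at
  \<open>j\<close>, or starts later and stays inside. The two crossings cost
  \<open>2 * (C + 1) * l\<close> each, the third case costs \<open>l\<close>, and the last costs the
  count for the prefix of length \<open>l\<close> plus \<open>l\<close>.\<close>

lemma card_meeting_le:
  assumes "near x j l"
  shows "card {p \<in> returns x K m. snd p \<le> l \<and> block p \<inter> block (j, l) \<noteq> {}}
    \<le> card (returns x K l) + (4 * C + 6) * l"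
proof -
  let ?E = "\<lambda>e. {(i, k) \<in> returns x K m. k \<le> l \<and> i < e \<and> e < i + k}"
  let ?I = "{(i, k) \<in> returns x K m. j < i \<and> i + k \<le> j + l}"
  have fin: "finite {(i, k) \<in> returns x K m. P i k}" for P
    by (rule finite_subset[OF _ finite_returns[of x K m]]) auto
  have "{p \<in> returns x K m. snd p \<le> l \<and> block p \<inter> block (j, l) \<noteq> {}}
      \<subseteq> ?E j \<union> (?E (j + l) \<union> ({j} \<times> {1..l} \<union> ?I))"
    using K_large by (auto simp: block_def returns_def)
  then have "card {p \<in> returns x K m. snd p \<le> l \<and> block p \<inter> block (j, l) \<noteq> {}}
      \<le> card (?E j \<union> (?E (j + l) \<union> ({j} \<times> {1..l} \<union> ?I)))"
    by (intro card_mono) (simp_all add: fin)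
  also have "\<dots> \<le> card (?E j) + (card (?E (j + l)) + (card ({j} \<times> {1..l}) + card ?I))"
    by (meson add_left_mono card_Un_le order_trans)
  also have "\<dots> \<le> 2 * (C + 1) * l + (2 * (C + 1) * l + (l + (card (returns x K l) + l)))"
    using card_straddling_le card_inside_le[OF assms]
    by (intro add_mono) (simp_all add: card_cartesian_product)
  also have "\<dots> = card (returns x K l) + (4 * C + 6) * l" by (simp add: algebra_simps)
  finally show ?thesis .
qed

text \<open>Each return meets a selected block at least as long as itself, so the count for
  \<open>m\<close> is bounded by counts for the block lengths plus a linear term. Since the selected
  blocks leave out a fraction \<open>\<epsilon>\<close> of the digits, the linear bound reproduces
  itself.\<close>

lemma card_returns_le:
  fixes \<epsilon> :: real
  assumes \<epsilon>: "0 < \<epsilon>"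
    and sparse: "\<And>m F. K \<le> m \<Longrightarrow> F \<subseteq> returns x K m \<Longrightarrow> disjoint_family_on block F \<Longrightarrow>
      real (\<Sum>p\<in>F. snd p) \<le> (1 - \<epsilon>) * real m"
  shows "real (card (returns x K m)) \<le> real (4 * C + 6) / \<epsilon> * real m"
proof (induction m rule: less_induct)
  case (less m)
  define c where "c = real (4 * C + 6)"
  show ?case
  proof (cases "K \<le> m")
    case False
    then have "returns x K m = {}" by (auto simp: returns_def)
    then show ?thesis using \<epsilon> by simp
  next
    case True
    have "block p \<noteq> {}" if "p \<in> returns x K m" for p
      using that K_large by (auto simp: returns_def block_def)
    then obtain F where F: "F \<subseteq> returns x K m" "disjoint_family_on block F"
      "\<And>p. p \<in> returns x K m \<Longrightarrow> \<exists>q\<in>F. snd p \<le> snd q \<and> block p \<inter> block q \<noteq> {}"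
      using finite_vitali[OF finite_returns, of x K m block snd] by metis
    have finF: "finite F" using F(1) finite_returns by (rule finite_subset)
    let ?M = "\<lambda>q. {p \<in> returns x K m. snd p \<le> snd q \<and> block p \<inter> block q \<noteq> {}}"
    have M: "real (card (?M q)) \<le> (c / \<epsilon> + c) * real (snd q)" if q: "q \<in> F" for q
    proof -
      obtain j l where jl: "q = (j, l)" by fastforce
      then have r: "1 \<le> j" "near x j l" "j + l \<le> m" using q F(1) by (auto simp: returns_def)
      have "card (?M q) \<le> card (returns x K l) + (4 * C + 6) * l"
        using card_meeting_le[OF r(2), of m] jl by simp
      then have "real (card (?M q)) \<le> real (card (returns x K l)) + c * real l"
        unfolding c_def of_nat_mult[symmetric] of_nat_add[symmetric] of_nat_le_iff .
      \<comment> \<open>The induction hypothesis applies because \<open>j \<ge> 1\<close> forces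
        \<open>l < m\<close>.\<close>
      moreover have "real (card (returns x K l)) \<le> c / \<epsilon> * real l"
        unfolding c_def using r by (intro less.IH) simp
      ultimately show ?thesis using jl by (simp add: distrib_right)
    qed
    have "card (returns x K m) \<le> card (\<Union>q\<in>F. ?M q)"
      using F(3) finF finite_returns by (intro card_mono) fastforce+
    also have "\<dots> \<le> (\<Sum>q\<in>F. card (?M q))" by (rule card_UN_le[OF finF])
    finally have "real (card (returns x K m)) \<le> (\<Sum>q\<in>F. real (card (?M q)))"
      unfolding of_nat_sum[symmetric] of_nat_le_iff .
    also have "\<dots> \<le> (\<Sum>q\<in>F. (c / \<epsilon> + c) * real (snd q))" by (intro sum_mono M)
    also have "\<dots> = (c / \<epsilon> + c) * real (\<Sum>q\<in>F. snd q)" by (simp add: sum_distrib_left)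
    also have "\<dots> \<le> (c / \<epsilon> + c) * ((1 - \<epsilon>) * real m)"
      using \<epsilon> by (intro mult_left_mono sparse[OF True F(1,2)]) (simp add: c_def)
    also have "\<dots> = (c / \<epsilon> - c * \<epsilon>) * real m" using \<epsilon> by (simp add: field_simps)
    also have "\<dots> \<le> c / \<epsilon> * real m" using \<epsilon> by (intro mult_right_mono) (simp_all add: c_def)
    finally show ?thesis by (simp add: c_def)
  qed
qed

end

subsection \<open>The exceptional set\<close>

text \<open>\<open>2 ^ i - 1\<close> divides \<open>2 ^ (i * j) - 1\<close>, so an exact return
  recurs at all multiples of \<open>i\<close>, in particular arbitrarily late.\<close>

lemma near_multiple_of_period:
  assumes "circ_norm ((2 ^ i - 1) * x) = 0"
  shows "near x (i * j) k"
proof -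
  have "(2 ^ (i * j) - 1 :: real) = (2 ^ i - 1) * (\<Sum>l<j. (2 ^ i) ^ l)"
    by (simp only: power_mult power_diff_1_eq)
  also have "(\<Sum>l<j. (2 ^ i) ^ l :: real) = of_int (\<Sum>l<j. (2 ^ i) ^ l)" by simp
  finally have eq: "(2 ^ (i * j) - 1) * x = of_int (\<Sum>l<j. (2 ^ i) ^ l) * ((2 ^ i - 1) * x)"
    by (simp only: mult.commute mult.left_commute)
  have "circ_norm ((2 ^ (i * j) - 1) * x) \<le> 0"
    unfolding eq
    by (rule order_trans[OF circ_norm_of_int_mult_le]) (simp add: assms)
  then show ?thesis unfolding near_def by (rule order_trans) simp
qed

lemma near_bounded:
  assumes "circ_norm ((2 ^ i - 1) * x) \<noteq> 0"
  shows "\<exists>b. \<forall>k. near x i k \<longrightarrow> k \<le> b"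
proof -
  have "0 < circ_norm ((2 ^ i - 1) * x)" using assms circ_norm_nonneg by (simp add: less_le)
  then obtain b where "(1 / 2) ^ b < circ_norm ((2 ^ i - 1) * x)"
    using real_arch_pow_inv[of _ "1 / 2"] by auto
  then have "\<not> near x i b" by (simp add: near_def power_one_over)
  then show ?thesis using near_mono nat_le_linear by blast
qed

text \<open>All \<open>k\<close> up to minus the logarithm of the distance qualify, and only those
  below \<open>K\<close> are left out. Finiteness is assumed because \<open>card\<close> is 0 on
  infinite sets.\<close>

lemma card_near_ge:
  assumes d: "circ_norm ((2 ^ i - 1) * x) \<noteq> 0" and fin: "finite {k. K \<le> k \<and> near x i k}"
  shows "- log 2 (circ_norm ((2 ^ i - 1) * x)) - real K \<le> real (card {k. K \<le> k \<and> near x i k})"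
proof -
  define a where "a = - log 2 (circ_norm ((2 ^ i - 1) * x))"
  have pos: "0 < circ_norm ((2 ^ i - 1) * x)" using d circ_norm_nonneg by (simp add: less_le)
  have near: "near x i k" if "real k \<le> a" for k
  proof -
    have "circ_norm ((2 ^ i - 1) * x) = 2 powr (- a)" using pos by (simp add: a_def)
    also have "\<dots> \<le> 2 powr (- real k)" using that by simp
    also have "\<dots> = 1 / 2 ^ k" by (simp add: powr_minus_divide powr_realpow)
    finally show ?thesis by (simp add: near_def)
  qed
  show ?thesis
  proof (cases "a \<le> real K")
    case False
    have "{K..nat \<lfloor>a\<rfloor>} \<subseteq> {k. K \<le> k \<and> near x i k}"
      using False by (auto intro!: near simp: le_nat_iff le_floor_iff)
    then have "card {K..nat \<lfloor>a\<rfloor>} \<le> card {k. K \<le> k \<and> near x i k}" using fin by (rule card_mono[rotated])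
    moreover have "a - real K \<le> real (card {K..nat \<lfloor>a\<rfloor>})" using False by simp linarith
    ultimately show ?thesis unfolding a_def by linarith
  qed (simp add: a_def[symmetric])
qed

text \<open>Up to \<open>K\<close> for each \<open>i\<close>, minus the sum of the logarithms is
  bounded by the number of pairs with \<open>i \<le> n\<close>. By \<open>near_le\<close> these
  pairs are returns within the first \<open>n + (C * n + B)\<close> digits, and their number is
  linear in \<open>n\<close>.\<close>

lemma (in slow_returns) log_sum_ge:
  assumes nz: "\<And>i. 1 \<le> i \<Longrightarrow> circ_norm ((2 ^ i - 1) * x) \<noteq> 0"
    and D: "0 \<le> D" "\<And>m. real (card (returns x K m)) \<le> D * real m"
    and n: "1 \<le> n"
  shows "- (real K + D * real (1 + C + B)) * real n \<le> (\<Sum>i=1..n. log 2 (circ_norm ((2 ^ i - 1) * x)))"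
proof -
  let ?d = "\<lambda>i. log 2 (circ_norm ((2 ^ i - 1) * x))"
  let ?S = "\<lambda>i. {k. K \<le> k \<and> near x i k}"
  have fin: "finite (?S i)" if "i \<in> {1..n}" for i
    using near_le that by (intro finite_subset[of "?S i" "{..C * i + B}"]) auto
  have "Sigma {1..n} ?S \<subseteq> returns x K (n + (C * n + B))"
  proof (clarsimp simp: returns_def)
    fix i k assume "Suc 0 \<le> i" "i \<le> n" "near x i k"
    then have "k \<le> C * i + B" "C * i \<le> C * n" using near_le by auto
    then show "i + k \<le> n + (C * n + B)" using \<open>i \<le> n\<close> by linarith
  qed
  then have "card (Sigma {1..n} ?S) \<le> card (returns x K (n + (C * n + B)))"
    by (intro card_mono finite_returns)
  then have "real (card (Sigma {1..n} ?S)) \<le> D * real (n + (C * n + B))"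
    using D(2)[of "n + (C * n + B)"] by linarith
  also have "\<dots> \<le> D * real ((1 + C + B) * n)"
  proof -
    have "B * 1 \<le> B * n" using n by (rule mult_le_mono2)
    then have "n + (C * n + B) \<le> (1 + C + B) * n" by (simp add: distrib_right)
    then show ?thesis using D(1) by (intro mult_left_mono) (simp_all only: of_nat_le_iff)
  qed
  also have "card (Sigma {1..n} ?S) = (\<Sum>i=1..n. card (?S i))"
    using fin by (intro card_SigmaI) auto
  finally have "(\<Sum>i=1..n. real (card (?S i))) \<le> D * real (1 + C + B) * real n"
    by (simp only: of_nat_sum of_nat_mult mult.assoc)
  moreover have "(\<Sum>i=1..n. - ?d i - real K) \<le> (\<Sum>i=1..n. real (card (?S i)))"
    using nz fin by (intro sum_mono card_near_ge) auto
  moreover have "(\<Sum>i=1..n. - ?d i - real K) = - (\<Sum>i=1..n. ?d i) - real K * real n"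
    by (simp add: sum_subtractf sum_negf)
  ultimately show ?thesis by (simp add: algebra_simps)
qed

text \<open>Without exact returns every summand is a real number. If the averages were at least
  \<open>- Q\<close> for all \<open>n \<ge> 1\<close>, then so would be their liminf.\<close>

lemma X_infty_log_sum_less:
  assumes x: "x \<in> X_infty" and nz: "\<And>i. 1 \<le> i \<Longrightarrow> circ_norm ((2 ^ i - 1) * x) \<noteq> 0"
  shows "\<exists>n\<ge>1. (\<Sum>i=1..n. log 2 (circ_norm ((2 ^ i - 1) * x))) < - Q * real n"
proof (rule ccontr)
  assume "\<not> ?thesis"
  then have ge: "- Q * real n \<le> (\<Sum>i=1..n. log 2 (circ_norm ((2 ^ i - 1) * x)))" if "1 \<le> n" for n
    using that by (meson not_less)
  let ?X = "\<lambda>n. ereal (1 / real n) * (\<Sum>i=1..n. elog2 (dT ((doubling ^^ i) x) x))"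
  have circ: "x \<in> circle" and lim: "liminf ?X = - \<infinity>" using x by (auto simp: X_infty_def)
  have "ereal (- Q) \<le> ?X n" if n: "1 \<le> n" for n
  proof -
    have "(\<Sum>i=1..n. elog2 (dT ((doubling ^^ i) x) x)) =
        (\<Sum>i=1..n. ereal (log 2 (circ_norm ((2 ^ i - 1) * x))))"
      by (intro sum.cong) (simp_all add: elog2_def dT_doubling_funpow[OF circ] nz)
    also have "\<dots> = ereal (\<Sum>i=1..n. log 2 (circ_norm ((2 ^ i - 1) * x)))" by (rule sum_ereal)
    finally have "?X n = ereal (1 / real n * (\<Sum>i=1..n. log 2 (circ_norm ((2 ^ i - 1) * x))))"
      by simp
    moreover have "- Q \<le> 1 / real n * (\<Sum>i=1..n. log 2 (circ_norm ((2 ^ i - 1) * x)))"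
      using ge[OF n] n by (simp add: field_simps)
    ultimately show ?thesis by (simp only: ereal_less_eq)
  qed
  then have "\<forall>\<^sub>F n in sequentially. ereal (- Q) \<le> ?X n" by (auto simp: eventually_sequentially)
  then have "ereal (- Q) \<le> liminf ?X" by (rule Liminf_bounded)
  then show False using lim by simp
qed

lemma X_infty_parse:
  assumes x: "x \<in> X_infty" and K_pos: "1 \<le> K" and \<epsilon>: "0 < \<epsilon>"
  shows "\<exists>m\<ge>N. parse K x m (nat \<lfloor>\<epsilon> * real m\<rfloor>)"
proof (rule ccontr)
  assume "\<not> ?thesis"
  then have not_parse: "u > nat \<lfloor>\<epsilon> * real m\<rfloor>" if "N \<le> m" "parse K x m u" for m u
    using that parse_mono by (meson not_le)
  \<comment> \<open>A copy of length \<open>C * i\<close> at position \<open>i\<close> leaves at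
    most \<open>i\<close> free digits among \<open>i + C * i\<close>; as
    \<open>C \<ge> 1 / \<epsilon>\<close>, this is within the allowed fraction
    \<open>\<epsilon>\<close>.\<close>
  define C where "C = nat \<lceil>1 / \<epsilon>\<rceil>"
  have C: "1 \<le> \<epsilon> * real C" "1 \<le> C"
  proof -
    have "1 / \<epsilon> \<le> real C" unfolding C_def by (rule real_nat_ceiling_ge)
    then show "1 \<le> \<epsilon> * real C" using \<epsilon> by (simp add: field_simps)
    then show "1 \<le> C" by (cases C) auto
  qed
  define M where "M = max N K"
  have late: "\<not> near x i (C * i)" if "M \<le> i" for i
  proof
    assume near: "near x i (C * i)"
    have "i \<le> C * i" using C(2) by simp
    moreover have "K \<le> i" "N \<le> i" using that by (simp_all add: M_def)
    ultimately have i: "K \<le> C * i" "1 \<le> i" "N \<le> i + C * i"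
      using K_pos by linarith+
    then have "parse K x (i + C * i) i" using near by (intro parse.copy parse_self)
    then have "nat \<lfloor>\<epsilon> * real (i + C * i)\<rfloor> < i" using not_parse i(3) by blast
    moreover have "i \<le> nat \<lfloor>\<epsilon> * real (i + C * i)\<rfloor>"
    proof (rule le_nat_floor)
      have "1 * real i \<le> \<epsilon> * real C * real i" using C(1) by (rule mult_right_mono) simp
      then show "real i \<le> \<epsilon> * real (i + C * i)" using \<epsilon> by (simp add: distrib_left add_increasing mult.assoc)
    qed
    ultimately show False by simp
  qed
  \<comment> \<open>An exact return at \<open>i\<close> would produce returns of every length at
    \<open>i * M \<ge> M\<close>, against \<open>late\<close>.\<close>
  have nz: "circ_norm ((2 ^ i - 1) * x) \<noteq> 0" if "1 \<le> i" for i
  proof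
    assume "circ_norm ((2 ^ i - 1) * x) = 0"
    then have "near x (i * M) (C * (i * M))" by (rule near_multiple_of_period)
    moreover have "M \<le> i * M" using mult_le_mono1[OF that, of M] by simp
    ultimately show False using late by blast
  qed
  then have "\<forall>i. \<exists>b. 1 \<le> i \<longrightarrow> (\<forall>k. near x i k \<longrightarrow> k \<le> b)" using near_bounded by metis
  then obtain b where b: "\<And>i k. 1 \<le> i \<Longrightarrow> near x i k \<Longrightarrow> k \<le> b i" by metis
  \<comment> \<open>Only finitely many positions precede \<open>M\<close>; the sum of their
    individual bounds dominates each of them.\<close>
  define B where "B = sum b {..<M}"
  have bound: "k \<le> C * i + B" if "1 \<le> i" "near x i k" for i k
  proof (cases "M \<le> i")
    case True
    have "\<not> C * i \<le> k" using late[OF True] near_mono[OF that(2)] by blast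
    then show ?thesis by simp
  next
    case False
    then have "b i \<le> B" unfolding B_def by (intro member_le_sum) auto
    then show ?thesis using b[OF that] by simp
  qed
  \<comment> \<open>Lengths of at least \<open>M\<close> are admissible copies and make
    \<open>not_parse\<close> applicable; \<open>2 * (B + 1)\<close> is what the locale
    requires.\<close>
  define K' where "K' = max M (2 * (B + 1))"
  interpret slow_returns x C B K'
    by unfold_locales (use bound in \<open>auto simp: K'_def\<close>)
  define D where "D = real (4 * C + 6) / \<epsilon>"
  have ret: "real (card (returns x K' m)) \<le> D * real m" for m
    unfolding D_def
  proof (rule card_returns_le[OF \<epsilon>])
    fix m F assume m: "K' \<le> m" and F: "F \<subseteq> returns x K' m" "disjoint_family_on block F"
    have "finite F" using F(1) finite_returns by (rule finite_subset)
    \<comment> \<open>Disjoint returns covering too much of the prefix would give a parse with too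
      few free digits.\<close>
    then have "parse K x m (m - (\<Sum>p\<in>F. snd p))"
      using F by (intro parse_of_blocks[OF _ _ K_pos]) (auto simp: returns_def K'_def M_def)
    moreover have "N \<le> m" using m by (simp add: K'_def M_def)
    ultimately have "nat \<lfloor>\<epsilon> * real m\<rfloor> < m - (\<Sum>p\<in>F. snd p)" using not_parse by blast
    then have "\<not> real (m - (\<Sum>p\<in>F. snd p)) \<le> \<epsilon> * real m" "(\<Sum>p\<in>F. snd p) \<le> m"
      using le_nat_floor[of "m - (\<Sum>p\<in>F. snd p)" "\<epsilon> * real m"] by linarith+
    then show "real (\<Sum>p\<in>F. snd p) \<le> (1 - \<epsilon>) * real m"
      by (simp add: of_nat_diff left_diff_distrib)
  qed
  have "0 \<le> D" using \<epsilon> by (simp add: D_def)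
  then show False
    using X_infty_log_sum_less[OF x nz, of "real K' + D * real (1 + C + B)"] log_sum_ge[OF nz _ ret]
    by (meson not_le)
qed

lemma hausdorff_measure_mono: "A \<subseteq> A' \<Longrightarrow> hausdorff_measure s A \<le> hausdorff_measure s A'"
  unfolding hausdorff_measure_def hausdorff_pre_def by (intro SUP_mono' INF_superset_mono) auto

theorem theorem4p1:
  shows "hausdorff_dim X_infty = 0"
proof (rule hausdorff_dim_eq_0)
  fix s :: real assume s: "0 < s"
  then obtain K where K: "1 \<le> K"
    "hausdorff_measure s {x \<in> circle. \<forall>N. \<exists>m\<ge>N. parse K x m (nat \<lfloor>s / 8 * real m\<rfloor>)} = 0"
    using hausdorff_measure_parse_limsup by blast
  have "X_infty \<subseteq> {x \<in> circle. \<forall>N. \<exists>m\<ge>N. parse K x m (nat \<lfloor>s / 8 * real m\<rfloor>)}"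
    using X_infty_parse[OF _ K(1), of _ "s / 8"] s by (auto simp: X_infty_def)
  from hausdorff_measure_mono[OF this, of s] show "hausdorff_measure s X_infty = 0"
    using K(2) by simp
qed

end
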